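(* Not all cobweb-admissible sequences are cobweb tiling sequences; that is, there exists a cobweb-admissible sequence $F=\{n_F\}_{n\ge 0}$ and integers $0\le k<n$ such that the layer $\langle \Phi_{k+1}\to\Phi_n\rangle$ of the cobweb poset of $F$ admits no partition into max-disjoint blocks of the form $\sigma P_m$, $m=n-k$.
   Context: Let $F=\{n_F\}_{n\ge0}$ be a sequence of positive integers with $0_F=1$. Define $n_F!=1_F\cdot 2_F\cdots n_F$ ($0_F!=1$), $n_F^{\underline{k}}=n_F(n-1)_F\cdots(n-k+1)_F$, and the $F$-nomial coefficients $\binom{n}{k}_F=\frac{n_F^{\underline{k}}}{k_F!}$. The sequence $F$ is called cobweb-admissible if $\binom{n}{k}_F$ is a nonnegative integer for all integers $n,k\ge0$ (with $\binom{n}{k}_F=0$ for $k>n$). The cobweb poset of $F$ is the graded poset whose vertex set is a disjoint union of levels $\Phi_s$, $s\ge 0$, with $|\Phi_s|=s_F$, and in which $x<y$ whenever $x\in\Phi_r$, $y\in\Phi_s$ with $r<s$ (so every vertex of $\Phi_s$ is covered by every vertex of $\Phi_{s+1}$). For $k<n$ the layer $\langle\Phi_{k+1}\to\Phi_n\rangle$ is the subposet on $\Phi_{k+1}\cup\dots\cup\Phi_n$; its maximal chains are the tuples $(x_{k+1},\dots,x_n)$ with $x_s\in\Phi_s$. With $m=n-k$, a block of the form $\sigma P_m$ in this layer is a subposet on $V_{k+1}\cup\dots\cup V_n$ with $V_s\subseteq\Phi_s$ such that $(|V_{k+1}|,\dots,|V_n|)$ is a permutation $\sigma$ of $(1_F,2_F,\dots,m_F)$;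 its set of maximal chains is $V_{k+1}\times\dots\times V_n$. Two blocks are max-disjoint if they have no maximal chain in common. A partition (tiling) of the layer by max-disjoint blocks $\sigma P_m$ is a family of such blocks whose sets of maximal chains partition the set of all maximal chains of the layer. A cobweb-admissible sequence is a cobweb tiling sequence if every layer $\langle\Phi_{k+1}\to\Phi_n\rangle$, $0\le k<n$, of its cobweb poset admits such a partition. *)

theory Defs
  imports Complex_Main "HOL-Library.FuncSet" "HOL-Combinatorics.Permutations"
begin

definition F_fact :: "(nat \<Rightarrow> nat) \<Rightarrow> nat \<Rightarrow> nat" where
  "F_fact F n = (\<Prod>i=1..n. F i)"

text \<open>For \<open>k > n\<close> the truncated subtraction makes this product meaningless; it is only used
  for \<open>k \<le> n\<close>.\<close>

definition F_falling :: "(nat \<Rightarrow> nat) \<Rightarrow> nat \<Rightarrow> nat \<Rightarrow> nat" where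
  "F_falling F n k = (\<Prod>i<k. F (n - i))"

definition F_nomial :: "(nat \<Rightarrow> nat) \<Rightarrow> nat \<Rightarrow> nat \<Rightarrow> rat" where
  "F_nomial F n k = (if k \<le> n then of_nat (F_falling F n k) / of_nat (F_fact F k) else 0)"

definition cobweb_admissible :: "(nat \<Rightarrow> nat) \<Rightarrow> bool" where
  "cobweb_admissible F \<longleftrightarrow> (\<forall>n. F n > 0) \<and> F 0 = 1 \<and> (\<forall>n k. F_nomial F n k \<in> \<nat>)"

text \<open>A vertex is a pair of its level and its position in that level.\<close>

definition level :: "(nat \<Rightarrow> nat) \<Rightarrow> nat \<Rightarrow> (nat \<times> nat) set" where
  "level F s = {s} \<times> {..<F s}"

definition cobweb_less :: "nat \<times> nat \<Rightarrow> nat \<times> nat \<Rightarrow> bool" where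
  "cobweb_less x y \<longleftrightarrow> fst x < fst y"

text \<open>The subposet on \<open>\<Phi>\<^sub>k\<^sub>+\<^sub>1 \<union> \<dots> \<union> \<Phi>\<^sub>n\<close>; all subposets carry the order \<open>cobweb_less\<close> and are given by
  their vertex sets.\<close>

definition layer :: "(nat \<Rightarrow> nat) \<Rightarrow> nat \<Rightarrow> nat \<Rightarrow> (nat \<times> nat) set" where
  "layer F k n = (\<Union>s\<in>{k+1..n}. level F s)"

definition max_chains :: "(nat \<times> nat) set \<Rightarrow> (nat \<times> nat) set set" where
  "max_chains W = {C. pred_on.maxchain W cobweb_less C}"

definition is_block :: "(nat \<Rightarrow> nat) \<Rightarrow> nat \<Rightarrow> nat \<Rightarrow> (nat \<times> nat) set \<Rightarrow> bool" where
  "is_block F k n W \<longleftrightarrow>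
     (\<exists>V \<sigma>. (\<forall>s\<in>{k+1..n}. V s \<subseteq> level F s) \<and>
            \<sigma> permutes {1..n-k} \<and>
            (\<forall>i\<in>{1..n-k}. card (V (k + i)) = F (\<sigma> i)) \<and>
            W = (\<Union>s\<in>{k+1..n}. V s))"

definition max_disjoint :: "(nat \<times> nat) set \<Rightarrow> (nat \<times> nat) set \<Rightarrow> bool" where
  "max_disjoint W W' \<longleftrightarrow> max_chains W \<inter> max_chains W' = {}"

definition is_tiling :: "(nat \<Rightarrow> nat) \<Rightarrow> nat \<Rightarrow> nat \<Rightarrow> (nat \<times> nat) set set \<Rightarrow> bool" where
  "is_tiling F k n \<B> \<longleftrightarrow>
     (\<forall>W\<in>\<B>. is_block F k n W) \<and>
     pairwise max_disjoint \<B> \<and>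
     (\<Union>W\<in>\<B>. max_chains W) = max_chains (layer F k n)"

definition cobweb_tiling :: "(nat \<Rightarrow> nat) \<Rightarrow> bool" where
  "cobweb_tiling F \<longleftrightarrow>
     cobweb_admissible F \<and> (\<forall>k n. k < n \<longrightarrow> (\<exists>\<B>. is_tiling F k n \<B>))"

text \<open>The maximal chains are exactly the ranges of the tuples \<open>(x\<^sub>k\<^sub>+\<^sub>1, \<dots>, x\<^sub>n)\<close> with \<open>x\<^sub>s \<in> V s\<close>.
  This covers layers and, for admissible \<open>F\<close>, blocks.\<close>

lemma max_chains_levelwise:
  assumes sub: "\<And>s. s \<in> S \<Longrightarrow> V s \<subseteq> level F s" and ne: "\<And>s. s \<in> S \<Longrightarrow> V s \<noteq> {}"
  shows "max_chains (\<Union>s\<in>S. V s) = (\<lambda>x. x ` S) ` (PiE S V)"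
proof (intro equalityI subsetI)
  let ?W = "\<Union>s\<in>S. V s"
  interpret pred_on ?W cobweb_less .
  have fstV: "fst v = s" if "s \<in> S" "v \<in> V s" for s v
    using sub[OF that(1)] that(2) by (auto simp: level_def)
  fix C assume "C \<in> max_chains ?W"
  then have mc: "maxchain C" by (simp add: max_chains_def)
  then have ch: "chain C" and CW: "C \<subseteq> ?W" by (auto simp: maxchain_def chain_def)
  have inj: "v = w" if "v \<in> C" "w \<in> C" "fst v = fst w" for v w
    using ch that unfolding chain_def cobweb_less_def by fastforce
  have ex: "\<exists>v\<in>C. fst v = s" if s: "s \<in> S" for s
  proof (rule ccontr)
    assume no: "\<not> ?thesis"
    obtain v where v: "v \<in> V s" using ne[OF s] by auto
    have "v \<notin> C" using no fstV[OF s v] by auto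
    moreover have "chain (insert v C)"
      unfolding chain_def
    proof (intro conjI ballI)
      show "insert v C \<subseteq> ?W" using CW s v by auto
      fix a b assume "a \<in> insert v C" "b \<in> insert v C"
      then show "cobweb_less\<^sup>=\<^sup>= a b \<or> cobweb_less\<^sup>=\<^sup>= b a"
        using ch no fstV[OF s v] by (auto simp: chain_def cobweb_less_def)
    qed
    ultimately show False using mc by (auto simp: maxchain_def)
  qed
  then obtain x where x: "\<And>s. s \<in> S \<Longrightarrow> x s \<in> C \<and> fst (x s) = s" by metis
  have xV: "x s \<in> V s" if "s \<in> S" for s
    using x[OF that] CW fstV by fastforce
  have "C = restrict x S ` S"
  proof (intro equalityI subsetI)
    fix v assume v: "v \<in> C"
    then obtain s where "s \<in> S" "v \<in> V s" using CW by auto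
    then show "v \<in> restrict x S ` S"
      using inj[OF v, of "x s"] x[of s] fstV[of s v] by (auto intro!: image_eqI[of _ _ s])
  qed (use x in auto)
  then show "C \<in> (\<lambda>x. x ` S) ` PiE S V" using xV by (intro image_eqI[of _ _ "restrict x S"]) auto
next
  let ?W = "\<Union>s\<in>S. V s"
  interpret pred_on ?W cobweb_less .
  have fstV: "fst v = s" if "s \<in> S" "v \<in> V s" for s v
    using sub[OF that(1)] that(2) by (auto simp: level_def)
  fix C assume "C \<in> (\<lambda>x. x ` S) ` (PiE S V)"
  then obtain x where x: "x \<in> PiE S V" and C: "C = x ` S" by auto
  have xs: "x s \<in> V s" "fst (x s) = s" if "s \<in> S" for s using x fstV that by (auto simp: PiE_mem)
  have "chain C"
    unfolding chain_def
  proof (intro conjI ballI)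
    show "C \<subseteq> ?W" using C xs by auto
    fix a b assume "a \<in> C" "b \<in> C"
    then obtain s t where st: "s \<in> S" "t \<in> S" "a = x s" "b = x t" using C by auto
    show "cobweb_less\<^sup>=\<^sup>= a b \<or> cobweb_less\<^sup>=\<^sup>= b a"
      using st xs(2)[of s] xs(2)[of t] by (cases s t rule: linorder_cases) (auto simp: cobweb_less_def)
  qed
  moreover have False if D: "chain D" "C \<subset> D" for D
  proof -
    obtain v where v: "v \<in> D" "v \<notin> C" using D by auto
    then obtain s where s: "s \<in> S" "v \<in> V s" using D(1) unfolding chain_def by blast
    then have "x s \<in> D" "fst (x s) = fst v" "x s \<noteq> v" using xs fstV C D v by auto
    then show False using D(1) v(1) unfolding chain_def cobweb_less_def by fastforce
  qed
  ultimately show "C \<in> max_chains ?W" by (auto simp: max_chains_def maxchain_def)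
qed

end

theory Submission
  imports Defs
begin

text \<open>
  The witness is \<open>F = 1, 1, 6, 2, 3, 2, 6, 1, 6, 2, 3, 2, 6, \<dots>\<close>, which from index 1 on has
  period 6. It is the product of \<open>1, 3, 1, 3, \<dots>\<close> and \<open>1, 2, 2, 1, 2, 2, \<dots>\<close>; in both of these
  the initial window of any length contains the fewest nontrivial factors among all windows of that
  length, so the initial product divides every other one and \<open>F\<close> is admissible. Levels 3 and 4 have
  2 and 3 vertices, whereas a block \<open>\<sigma>P\<^sub>2\<close> needs \<open>2\<^sub>F = 6\<close> vertices on one level. Hence no block
  fits into the layer \<open>\<langle>\<Phi>\<^sub>3 \<rightarrow> \<Phi>\<^sub>4\<rangle>\<close>.
\<close>

text \<open>Periodic from index 0 on, with value 6 there, so that every window can be shifted modulo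
  6; the required value 1 at index 0 enters only in \<open>cobF\<close>.\<close>

definition cyc6 :: "nat \<Rightarrow> nat" where
  "cyc6 n = (if even n then 3 else 1) * (if n mod 3 = 1 then 1 else 2)"

definition cobF :: "nat \<Rightarrow> nat" where
  "cobF n = (if n = 0 then 1 else cyc6 n)"

lemma cyc6_mod6: "cyc6 (a + i) = cyc6 (a mod 6 + i)"
proof -
  have "even (a + i) \<longleftrightarrow> even (a mod 6 + i)"
    by (simp add: dvd_mod_iff)
  moreover have "(a + i) mod 3 = (a mod 6 + i) mod 3"
    by (rule mod_add_cong) (simp_all add: mod_mod_cancel)
  ultimately show ?thesis
    by (simp only: cyc6_def)
qed

lemma prod_cyc6_mod6: "(\<Prod>i<k. cyc6 (a + i)) = (\<Prod>i<k. cyc6 (a mod 6 + i))"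
  by (rule prod.cong[OF refl cyc6_mod6])

lemma cyc6_values:
  "cyc6 0 = 6" "cyc6 (Suc 0) = 1" "cyc6 2 = 6" "cyc6 3 = 2" "cyc6 4 = 3" "cyc6 5 = 2"
  "cyc6 6 = 6" "cyc6 7 = 1" "cyc6 8 = 6" "cyc6 9 = 2" "cyc6 10 = 3"
  "cyc6 (Suc (Suc 0)) = 6" "cyc6 (Suc (Suc (Suc 0))) = 2"
  by (simp_all add: cyc6_def)

lemma lessThan_upto_6:
  "{..<2::nat} = {0,1}" "{..<3::nat} = {0,1,2}" "{..<4::nat} = {0,1,2,3}"
  "{..<5::nat} = {0,1,2,3,4}" "{..<6::nat} = {0,1,2,3,4,5}"
  by auto

lemma less_6_disj:
  fixes n :: nat
  shows "n < 6 \<Longrightarrow> n = 0 \<or> n = 1 \<or> n = 2 \<or> n = 3 \<or> n = 4 \<or> n = 5"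
  by linarith

lemma prod_cyc6_period: "(\<Prod>i<6. cyc6 (a + i)) = 432"
proof -
  have "(\<Prod>i<6. cyc6 (b + i)) = 432" if "b < 6" for b
    using less_6_disj[OF that] by (elim disjE) (simp_all add: lessThan_upto_6 cyc6_values)
  then show ?thesis
    by (subst prod_cyc6_mod6) simp
qed

lemma prod_lessThan_add:
  fixes f :: "nat \<Rightarrow> 'a::comm_monoid_mult"
  shows "(\<Prod>i<k + m. f i) = (\<Prod>i<k. f i) * (\<Prod>i<m. f (k + i))"
  by (induction m) (simp_all add: mult.assoc)

lemma prod_cyc6_add6: "(\<Prod>i<k + 6. cyc6 (a + i)) = (\<Prod>i<k. cyc6 (a + i)) * 432"
  unfolding prod_lessThan_add add.assoc[symmetric] prod_cyc6_period ..

text \<open>Six consecutive factors contribute 432 to both sides, so induction strips full periods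
  until \<open>k < 6\<close>. There only \<open>a mod 6\<close> matters, which leaves 36 numerical
  cases.\<close>

lemma initial_prod_cyc6_dvd: "(\<Prod>i<k. cyc6 (1 + i)) dvd (\<Prod>i<k. cyc6 (a + i))"
proof (induction k rule: less_induct)
  case (less k)
  show ?case
  proof (cases "k < 6")
    case True
    have "(\<Prod>i<k. cyc6 (1 + i)) dvd (\<Prod>i<k. cyc6 (b + i))" if "b < 6" for b
      using less_6_disj[OF True] less_6_disj[OF that]
      by (elim disjE) (simp_all add: lessThan_upto_6 cyc6_values)
    from this[of "a mod 6"] show ?thesis
      unfolding prod_cyc6_mod6[of a k, symmetric] by simp
  next
    case False
    then obtain j where j: "k = j + 6" by (metis add.commute le_Suc_ex not_less)
    show ?thesis
      unfolding j prod_cyc6_add6 using less.IH[of j] j by (intro mult_dvd_mono) auto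
  qed
qed

lemma F_fact_cobF: "F_fact cobF k = (\<Prod>i<k. cyc6 (1 + i))"
  unfolding F_fact_def by (induction k) (simp_all add: cobF_def)

text \<open>Read backwards, the falling product is a window of \<open>cyc6\<close> starting at
  \<open>n - k + 1\<close>, so it never meets the exceptional index 0.\<close>

lemma F_falling_cobF:
  assumes "k \<le> n"
  shows "F_falling cobF n k = (\<Prod>i<k. cyc6 (n - k + 1 + i))"
proof -
  have "F_falling cobF n k = (\<Prod>i<k. cyc6 (n - k + 1 + (k - Suc i)))"
    unfolding F_falling_def using assms by (intro prod.cong) (auto simp: cobF_def Suc_diff_Suc)
  also have "\<dots> = (\<Prod>i<k. cyc6 (n - k + 1 + i))"
    by (rule prod.nat_diff_reindex)
  finally show ?thesis .
qed

lemma cobF_pos: "cobF n > 0"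
  by (simp add: cobF_def cyc6_def)

lemma cobweb_admissible_cobF: "cobweb_admissible cobF"
proof -
  have "F_nomial cobF n k \<in> \<nat>" for n k
  proof (cases "k \<le> n")
    case True
    have "F_fact cobF k dvd F_falling cobF n k"
      unfolding F_fact_cobF F_falling_cobF[OF True] by (rule initial_prod_cyc6_dvd)
    then obtain c where c: "F_falling cobF n k = F_fact cobF k * c" ..
    have "F_fact cobF k > 0"
      unfolding F_fact_def using cobF_pos by (intro prod_pos) auto
    then show ?thesis using True c by (simp add: F_nomial_def)
  qed (simp add: F_nomial_def)
  then show ?thesis
    using cobF_pos by (auto simp: cobweb_admissible_def cobF_def)
qed

lemma no_block_cobF_2_4: "\<not> is_block cobF 2 4 W"
proof
  assume "is_block cobF 2 4 W"
  then obtain V \<sigma> where V: "\<forall>s\<in>{2+1..4}. V s \<subseteq> level cobF s"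
    and "\<sigma> permutes {1..4-2}"
    and "\<forall>i\<in>{1..4-2}. card (V (2 + i)) = cobF (\<sigma> i)"
    unfolding is_block_def by blast
  then have \<sigma>: "\<sigma> permutes {1..2}"
    and card: "\<And>i. i \<in> {1..2} \<Longrightarrow> card (V (2 + i)) = cobF (\<sigma> i)"
    by simp_all
  \<comment> \<open>Some level \<open>2 + i\<close> of the block has to carry \<open>cobF 2\<close>,
    that is 6, vertices.\<close>
  have "2 \<in> \<sigma> ` {1..2}" using permutes_image[OF \<sigma>] by simp
  then obtain i where i: "i \<in> {1..2}" "\<sigma> i = 2" by (metis imageE)
  have "card (V (2 + i)) \<le> card (level cobF (2 + i))"
    using i V by (intro card_mono) (auto simp: level_def)
  then have "cobF 2 \<le> cobF (2 + i)"
    using card[OF i(1)] i(2) by (simp add: level_def)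
  moreover have "i = 1 \<or> i = 2" using i(1) by auto
  ultimately show False by (auto simp: cobF_def cyc6_values)
qed

text \<open>Excludes the empty family as a tiling: with no block available, there must be a chain
  left uncovered.\<close>

lemma max_chains_layer_nonempty:
  assumes "\<And>s. F s > 0"
  shows "max_chains (layer F k n) \<noteq> {}"
proof -
  have "level F s \<noteq> {}" for s using assms[of s] by (auto simp: level_def)
  then show ?thesis
    unfolding layer_def by (subst max_chains_levelwise) (auto simp: PiE_eq_empty_iff)
qed

lemma no_tiling_cobF_2_4: "\<not> is_tiling cobF 2 4 \<B>"
proof
  assume "is_tiling cobF 2 4 \<B>"
  then have "\<B> = {}" "(\<Union>W\<in>\<B>. max_chains W) = max_chains (layer cobF 2 4)"
    using no_block_cobF_2_4 by (auto simp: is_tiling_def)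
  then show False
    using max_chains_layer_nonempty[of cobF, OF cobF_pos] by auto
qed

theorem theorem3:
  "\<not> (\<forall>F. cobweb_admissible F \<longrightarrow> cobweb_tiling F) \<and>
   (\<exists>F k n. cobweb_admissible F \<and> k < n \<and> \<not> (\<exists>\<B>. is_tiling F k n \<B>))"
proof -
  have "cobweb_admissible cobF \<and> (2::nat) < 4 \<and> \<not> (\<exists>\<B>. is_tiling cobF 2 4 \<B>)"
    using cobweb_admissible_cobF no_tiling_cobF_2_4 by simp
  then show ?thesis
    unfolding cobweb_tiling_def by blast
qed

end
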